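(* Let $X_1$ and $X_2$ be Banach spaces and let $\alpha$ be a reasonable cross norm on $X_1\otimes X_2$. Then, for every $r\ge1$, the metric space $(\mathcal{S}^r_{X_1,X_2},d_\alpha)$ is complete.
   Context: Banach spaces are over the same field $\mathbb{R}$ or $\mathbb{C}$; $X_1\otimes X_2$ is the algebraic tensor product. A norm $\alpha$ on $X_1\otimes X_2$ is a reasonable cross norm if $\alpha(x_1\otimes x_2)\le\|x_1\|\|x_2\|$ for all $x_i\in X_i$, and for all $x_i^*\in X_i^*$ the functional $x_1^*\otimes x_2^*$ is bounded for $\alpha$ with norm at most $\|x_1^*\|\|x_2^*\|$. The rank of $z\in X_1\otimes X_2$ is the least $r$ such that $z=\sum_{i=1}^r x_1^i\otimes x_2^i$; $\mathcal{S}^r_{X_1,X_2}$ is the set of $z\in X_1\otimes X_2$ of rank $\le r$, and $d_\alpha(w,z)=\alpha(w-z)$. *)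

theory Defs
  imports "HOL-Analysis.Analysis" "HOL-Library.Function_Algebras"
begin

section \<open>Banach spaces over the real or complex field\<close>

class real_or_complex_field = real_normed_field +
  assumes isometric_iso_real_or_complex:
    "(\<exists>h::'a \<Rightarrow> real. bij h \<and> (\<forall>x y. h (x + y) = h x + h y) \<and>
        (\<forall>x y. h (x * y) = h x * h y) \<and> (\<forall>x. norm (h x) = norm x)) \<or>
     (\<exists>h::'a \<Rightarrow> complex. bij h \<and> (\<forall>x y. h (x + y) = h x + h y) \<and>
        (\<forall>x y. h (x * y) = h x * h y) \<and> (\<forall>x. norm (h x) = norm x))"

instance real :: real_or_complex_field
  by standard (rule disjI1, rule exI[of _ "\<lambda>x. x"], simp add: bij_id[unfolded id_def])

instance complex :: real_or_complex_field
  by standard (rule disjI2, rule exI[of _ "\<lambda>x. x"], simp add: bij_id[unfolded id_def])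

text \<open>The type class \<^class>\<open>banach\<close> provides the norm, its completeness and the underlying
  real vector space; \<open>s\<close> is the scalar multiplication of the field \<open>'k\<close>, of which
  the real structure of the type is the restriction.\<close>

locale banach_space_over = vector_space s
  for s :: "'k::real_or_complex_field \<Rightarrow> 'a::banach \<Rightarrow> 'a" +
  assumes scale_of_real: "s (of_real t) x = t *\<^sub>R x"
    and norm_scale: "norm (s c x) = norm c * norm x"

definition topological_dual ::
    "('k::real_or_complex_field \<Rightarrow> 'a::banach \<Rightarrow> 'a) \<Rightarrow> ('a \<Rightarrow> 'k) set" where
  "topological_dual s = {f. Vector_Spaces.linear s (*) f \<and> bounded_linear f}"


section \<open>The algebraic tensor product\<close>

definition bilinear_map ::
    "('k::field \<Rightarrow> 'a::ab_group_add \<Rightarrow> 'a) \<Rightarrow> ('k \<Rightarrow> 'b::ab_group_add \<Rightarrow> 'b) \<Rightarrow>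
     ('k \<Rightarrow> 'c::ab_group_add \<Rightarrow> 'c) \<Rightarrow> ('a \<Rightarrow> 'b \<Rightarrow> 'c) \<Rightarrow> bool" where
  "bilinear_map s1 s2 s3 \<phi> \<longleftrightarrow>
     (\<forall>y. Vector_Spaces.linear s1 s3 (\<lambda>x. \<phi> x y)) \<and> (\<forall>x. Vector_Spaces.linear s2 s3 (\<phi> x))"

text \<open>The tensor product is realised inside the space of functionals on the bilinear forms:
  \<open>x \<otimes> y\<close> is evaluation of bilinear forms at \<open>(x, y)\<close>, and the tensor product is
  the linear span of these functionals. As functions in HOL are total, elementary tensors are
  extended by \<open>0\<close> to functions \<open>B\<close> that are not bilinear forms. Vector addition is the
  pointwise one on functions. The universal property is proved below.\<close>

definition tensor ::
    "('k::field \<Rightarrow> 'a::ab_group_add \<Rightarrow> 'a) \<Rightarrow> ('k \<Rightarrow> 'b::ab_group_add \<Rightarrow> 'b) \<Rightarrow>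
     'a \<Rightarrow> 'b \<Rightarrow> (('a \<Rightarrow> 'b \<Rightarrow> 'k) \<Rightarrow> 'k)" where
  "tensor s1 s2 x y = (\<lambda>B. if bilinear_map s1 s2 (*) B then B x y else 0)"

definition scale_fun :: "'k::field \<Rightarrow> ('i \<Rightarrow> 'k) \<Rightarrow> ('i \<Rightarrow> 'k)" where
  "scale_fun c z = (\<lambda>i. c * z i)"

definition tensor_space ::
    "('k::field \<Rightarrow> 'a::ab_group_add \<Rightarrow> 'a) \<Rightarrow> ('k \<Rightarrow> 'b::ab_group_add \<Rightarrow> 'b) \<Rightarrow>
     (('a \<Rightarrow> 'b \<Rightarrow> 'k) \<Rightarrow> 'k) set" where
  "tensor_space s1 s2 = module.span scale_fun {tensor s1 s2 x y | x y. True}"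

lemma vector_space_scale_fun: "vector_space (scale_fun :: 'k::field \<Rightarrow> ('i \<Rightarrow> 'k) \<Rightarrow> 'i \<Rightarrow> 'k)"
  by unfold_locales (auto simp: scale_fun_def fun_eq_iff algebra_simps)

lemma vector_space_mult: "vector_space ((*) :: 'k::field \<Rightarrow> 'k \<Rightarrow> 'k)"
  by unfold_locales (auto simp: algebra_simps)

lemma bilinear_map_tensor:
  assumes "vector_space s1" "vector_space s2"
  shows "bilinear_map s1 s2 scale_fun (tensor s1 s2)"
  using assms vector_space_scale_fun
  by (auto simp: bilinear_map_def Vector_Spaces.linear_iff tensor_def scale_fun_def fun_eq_iff)

lemma separating_functional:
  fixes s :: "'k::field \<Rightarrow> 'c::ab_group_add \<Rightarrow> 'c"
  assumes "vector_space s" "z \<noteq> 0"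
  obtains \<psi> where "Vector_Spaces.linear s (*) \<psi>" "\<psi> z \<noteq> 0"
proof -
  interpret vector_space_pair s "(*) :: 'k \<Rightarrow> 'k \<Rightarrow> 'k"
    using assms(1) vector_space_mult by (rule vector_space_pair.intro)
  have "vs1.independent {z}" using assms(2) by simp
  from linear_independent_extend[OF this, of "\<lambda>_. 1"]
  obtain g where "Vector_Spaces.linear s (*) g" "g z = 1" by auto
  then show thesis using that[of g] by simp
qed

theorem tensor_universal_property:
  fixes s1 :: "'k::field \<Rightarrow> 'a::ab_group_add \<Rightarrow> 'a" and s2 :: "'k \<Rightarrow> 'b::ab_group_add \<Rightarrow> 'b"
    and s3 :: "'k \<Rightarrow> 'c::ab_group_add \<Rightarrow> 'c"
  assumes "vector_space s3" and \<phi>: "bilinear_map s1 s2 s3 \<phi>"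
  shows "\<exists>L. Vector_Spaces.linear scale_fun s3 L \<and> (\<forall>x y. L (tensor s1 s2 x y) = \<phi> x y) \<and>
     (\<forall>L'. Vector_Spaces.linear scale_fun s3 L' \<and> (\<forall>x y. L' (tensor s1 s2 x y) = \<phi> x y) \<longrightarrow>
        (\<forall>z\<in>tensor_space s1 s2. L' z = L z))"
proof -
  interpret vector_space_pair "scale_fun :: 'k \<Rightarrow> (('a \<Rightarrow> 'b \<Rightarrow> 'k) \<Rightarrow> 'k) \<Rightarrow> _" s3
    using vector_space_scale_fun assms(1) by (rule vector_space_pair.intro)
  let ?E = "{tensor s1 s2 x y | x y. True}"
  obtain B where B: "B \<subseteq> ?E" "vs1.independent B" "?E \<subseteq> vs1.span B"
    using vs1.maximal_independent_subset by blast
  then have "\<forall>b\<in>B. \<exists>x y. b = tensor s1 s2 x y" by blast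
  then obtain X Y where XY: "\<And>b. b \<in> B \<Longrightarrow> b = tensor s1 s2 (X b) (Y b)" by metis
  obtain L where L: "Vector_Spaces.linear scale_fun s3 L"
    and LB: "\<And>b. b \<in> B \<Longrightarrow> L b = \<phi> (X b) (Y b)"
    using linear_independent_extend[OF B(2), of "\<lambda>b. \<phi> (X b) (Y b)"] by auto
  have eval: "tensor s1 s2 x y (\<lambda>x y. \<psi> (\<phi> x y)) = \<psi> (\<phi> x y)"
    if "Vector_Spaces.linear s3 (*) \<psi>" for \<psi> x y
  proof -
    have "bilinear_map s1 s2 (*) (\<lambda>x y. \<psi> (\<phi> x y))"
      using \<phi> that by (auto simp: bilinear_map_def Vector_Spaces.linear_iff)
    then show ?thesis by (simp add: tensor_def)
  qed
  have L_tensor: "L (tensor s1 s2 x y) = \<phi> x y" for x y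
  proof (rule ccontr)
    assume "L (tensor s1 s2 x y) \<noteq> \<phi> x y"
    then obtain \<psi> where \<psi>: "Vector_Spaces.linear s3 (*) \<psi>" "\<psi> (L (tensor s1 s2 x y) - \<phi> x y) \<noteq> 0"
      using separating_functional[OF assms(1), of "L (tensor s1 s2 x y) - \<phi> x y"] by auto
    interpret P: Vector_Spaces.linear s3 "(*)" \<psi> by (fact \<psi>)
    have "Vector_Spaces.linear scale_fun (*) (\<lambda>z. \<psi> (L z))"
      using L \<psi>(1) by (auto simp: Vector_Spaces.linear_iff)
    moreover have "Vector_Spaces.linear scale_fun (*) (\<lambda>z. z (\<lambda>x y. \<psi> (\<phi> x y)))"
      using vector_space_scale_fun vector_space_mult
      by (auto simp: Vector_Spaces.linear_iff scale_fun_def)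
    moreover have "tensor s1 s2 x y \<in> vs1.span B" using B(3) by blast
    moreover have "\<psi> (L b) = b (\<lambda>x y. \<psi> (\<phi> x y))" if "b \<in> B" for b
      using XY[OF that] LB[OF that] eval[OF \<psi>(1)] by metis
    ultimately have "\<psi> (L (tensor s1 s2 x y)) = tensor s1 s2 x y (\<lambda>x y. \<psi> (\<phi> x y))"
      using vector_space_pair.linear_eq_on[OF vector_space_pair.intro[OF vector_space_scale_fun vector_space_mult]]
      by blast
    with \<psi> eval show False by (simp add: P.diff)
  qed
  moreover have "L' z = L z" if "Vector_Spaces.linear scale_fun s3 L'"
    "\<forall>x y. L' (tensor s1 s2 x y) = \<phi> x y" "z \<in> tensor_space s1 s2" for L' z
    using linear_eq_on[OF that(1) L that(3)[unfolded tensor_space_def]] that(2) L_tensor by fastforce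
  ultimately show ?thesis using L by blast
qed

text \<open>The functional \<open>f \<otimes> g\<close> sends \<open>x \<otimes> y\<close> to \<open>f x * g y\<close>,
  so it is evaluation at the bilinear form \<open>(x, y) \<mapsto> f x * g y\<close>.\<close>

definition tensor_functional ::
    "('a \<Rightarrow> 'k::field) \<Rightarrow> ('b \<Rightarrow> 'k) \<Rightarrow> (('a \<Rightarrow> 'b \<Rightarrow> 'k) \<Rightarrow> 'k) \<Rightarrow> 'k" where
  "tensor_functional f g z = z (\<lambda>x y. f x * g y)"

lemma tensor_functional_tensor:
  assumes "Vector_Spaces.linear s1 (*) f" "Vector_Spaces.linear s2 (*) g"
  shows "tensor_functional f g (tensor s1 s2 x y) = f x * g y"
proof -
  have "bilinear_map s1 s2 (*) (\<lambda>x y. f x * g y)"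
    using assms by (auto simp: bilinear_map_def Vector_Spaces.linear_iff algebra_simps)
  then show ?thesis by (simp add: tensor_functional_def tensor_def)
qed


section \<open>Reasonable cross norms and tensors of bounded rank\<close>

definition norm_on :: "('k::real_normed_field \<Rightarrow> 'v::ab_group_add \<Rightarrow> 'v) \<Rightarrow> 'v set \<Rightarrow> ('v \<Rightarrow> real) \<Rightarrow> bool" where
  "norm_on s V \<alpha> \<longleftrightarrow>
     (\<forall>z\<in>V. 0 \<le> \<alpha> z) \<and>
     (\<forall>z\<in>V. \<alpha> z = 0 \<longleftrightarrow> z = 0) \<and>
     (\<forall>c. \<forall>z\<in>V. \<alpha> (s c z) = norm c * \<alpha> z) \<and>
     (\<forall>w\<in>V. \<forall>z\<in>V. \<alpha> (w + z) \<le> \<alpha> w + \<alpha> z)"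

definition reasonable_cross_norm ::
    "('k::real_or_complex_field \<Rightarrow> 'a::banach \<Rightarrow> 'a) \<Rightarrow> ('k \<Rightarrow> 'b::banach \<Rightarrow> 'b) \<Rightarrow>
     ((('a \<Rightarrow> 'b \<Rightarrow> 'k) \<Rightarrow> 'k) \<Rightarrow> real) \<Rightarrow> bool" where
  "reasonable_cross_norm s1 s2 \<alpha> \<longleftrightarrow>
     norm_on scale_fun (tensor_space s1 s2) \<alpha> \<and>
     (\<forall>x y. \<alpha> (tensor s1 s2 x y) \<le> norm x * norm y) \<and>
     (\<forall>f\<in>topological_dual s1. \<forall>g\<in>topological_dual s2. \<forall>z\<in>tensor_space s1 s2.
        norm (tensor_functional f g z) \<le> onorm f * onorm g * \<alpha> z)"

definition tensor_rank ::
    "('k::field \<Rightarrow> 'a::ab_group_add \<Rightarrow> 'a) \<Rightarrow> ('k \<Rightarrow> 'b::ab_group_add \<Rightarrow> 'b) \<Rightarrow>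
     (('a \<Rightarrow> 'b \<Rightarrow> 'k) \<Rightarrow> 'k) \<Rightarrow> nat" where
  "tensor_rank s1 s2 z = (LEAST r. \<exists>x y. z = (\<Sum>i<r. tensor s1 s2 (x i) (y i)))"

definition rank_le_tensors ::
    "('k::field \<Rightarrow> 'a::ab_group_add \<Rightarrow> 'a) \<Rightarrow> ('k \<Rightarrow> 'b::ab_group_add \<Rightarrow> 'b) \<Rightarrow> nat \<Rightarrow>
     (('a \<Rightarrow> 'b \<Rightarrow> 'k) \<Rightarrow> 'k) set" where
  "rank_le_tensors s1 s2 r = {z \<in> tensor_space s1 s2. tensor_rank s1 s2 z \<le> r}"

text \<open>The value \<open>0\<close> off the tensor product only serves \<^locale>\<open>Metric_space\<close>, which asks
  for nonnegativity and symmetry on the whole type; \<open>\<alpha>\<close> is arbitrary there.\<close>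

definition tensor_dist ::
    "('k::field \<Rightarrow> 'a::ab_group_add \<Rightarrow> 'a) \<Rightarrow> ('k \<Rightarrow> 'b::ab_group_add \<Rightarrow> 'b) \<Rightarrow>
     ((('a \<Rightarrow> 'b \<Rightarrow> 'k) \<Rightarrow> 'k) \<Rightarrow> real) \<Rightarrow>
     (('a \<Rightarrow> 'b \<Rightarrow> 'k) \<Rightarrow> 'k) \<Rightarrow> (('a \<Rightarrow> 'b \<Rightarrow> 'k) \<Rightarrow> 'k) \<Rightarrow> real" where
  "tensor_dist s1 s2 \<alpha> w z =
     (if w \<in> tensor_space s1 s2 \<and> z \<in> tensor_space s1 s2 then \<alpha> (w - z) else 0)"

end

theory Submission
  imports Defs
begin

text \<open>
  The idea is to peel off one convergent elementary tensor at a time. If \<open>c = (f \<otimes> g)(z) \<noteq> 0\<close>,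
  subtracting \<open>c\<^sup>-\<^sup>1 (id \<otimes> g)(z) \<otimes> (f \<otimes> id)(z)\<close> from \<open>z\<close> lowers its rank (Wedderburn's rank
  reduction). Since \<open>\<alpha>\<close> dominates the injective norm, along an \<open>\<alpha>\<close>-Cauchy sequence the slices
  \<open>(id \<otimes> g)(z\<^sub>n)\<close> and \<open>(f \<otimes> id)(z\<^sub>n)\<close> converge in the factors. So if some \<open>(f \<otimes> g)(z\<^sub>n)\<close> does
  not tend to \<open>0\<close>, the subtracted elementary tensors converge and induction on the rank applies
  to the remainders. Otherwise \<open>z\<^sub>n\<close> tends to \<open>0\<close> in the injective norm, which on tensors of
  rank at most \<open>r\<close> dominates \<open>\<alpha>\<close> up to a constant: this is again rank reduction, now with
  \<open>f\<close> and \<open>g\<close> nearly attaining the injective norm.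
\<close>

section \<open>Norming functionals\<close>

definition sublinear :: "('a::real_vector \<Rightarrow> real) \<Rightarrow> bool" where
  "sublinear q \<longleftrightarrow>
     (\<forall>x y. q (x + y) \<le> q x + q y) \<and> (\<forall>t x. 0 \<le> t \<longrightarrow> q (t *\<^sub>R x) \<le> t * q x)"

lemma sublinear_add: "sublinear q \<Longrightarrow> q (x + y) \<le> q x + q y"
  by (simp add: sublinear_def)

lemma sublinear_scale_le: "sublinear q \<Longrightarrow> 0 \<le> t \<Longrightarrow> q (t *\<^sub>R x) \<le> t * q x"
  by (simp add: sublinear_def)

lemma sublinear_zero: "sublinear q \<Longrightarrow> q 0 = 0"
  using sublinear_scale_le[of q 0 0] sublinear_add[of q 0 0] by simp

lemma sublinear_minus_le: "sublinear q \<Longrightarrow> - q (- x) \<le> q x"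
  using sublinear_add[of q x "- x"] sublinear_zero[of q] by simp

text \<open>Scaling back by \<open>1 / t\<close> turns the inequality of \<open>sublinear\<close>
  into an equality, so only the inequality has to be checked for the infima constructed
  below.\<close>

lemma sublinear_scale:
  assumes "sublinear q" "0 \<le> t"
  shows "q (t *\<^sub>R x) = t * q x"
proof (cases "t = 0")
  case False
  then have "q x \<le> (1 / t) * q (t *\<^sub>R x)"
    using sublinear_scale_le[OF assms(1), of "1 / t" "t *\<^sub>R x"] assms(2) by simp
  then have "t * q x \<le> q (t *\<^sub>R x)"
    using False assms(2) by (simp add: field_simps)
  then show ?thesis using sublinear_scale_le[OF assms] by (simp add: antisym)
qed (simp add: sublinear_zero[OF assms(1)])

text \<open>\<open>p x\<close> is the infimum of \<open>q (x + t *\<^sub>R y) - t * q y\<close> over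
  \<open>t \<ge> 0\<close>: the choice \<open>t = 0\<close> gives \<open>p \<le> q\<close>, and
  \<open>t = 1\<close> at \<open>- y\<close> gives \<open>p (- y) \<le> q 0 - q y\<close>. The
  norming theorem uses it twice, for the value at the given point and for oddness.\<close>

lemma sublinear_decrease:
  fixes q :: "'a::real_vector \<Rightarrow> real"
  assumes q: "sublinear q"
  obtains p where "sublinear p" "p \<le> q" "p (- y) \<le> - q y"
proof -
  define F where "F x t = q (x + t *\<^sub>R y) - t * q y" for x and t :: real
  define p where "p x = (INF t\<in>{0..}. F x t)" for x
  \<comment> \<open>Subadditivity gives
    \<open>t * q y \<le> q (x + t *\<^sub>R y) + q (- x)\<close>, so the infimum is finite.\<close>
  have "- q (- x) \<le> F x t" if "0 \<le> t" for x t
    using sublinear_add[OF q, of "x + t *\<^sub>R y" "- x"] sublinear_scale[OF q that, of y]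
    by (simp add: F_def)
  then have bdd: "bdd_below (F x ` {0..})" for x
    by (intro bdd_belowI[of _ "- q (- x)"]) auto
  have p_le: "p x \<le> F x t" if "0 \<le> t" for x t
    unfolding p_def using that by (intro cINF_lower[OF bdd]) auto
  have p_ge: "c \<le> p x" if "\<And>t. 0 \<le> t \<Longrightarrow> c \<le> F x t" for x c
    unfolding p_def using that by (intro cINF_greatest) auto
  have F_add: "F (x + x') (t + t') \<le> F x t + F x' t'" for x x' t t'
    using sublinear_add[OF q, of "x + t *\<^sub>R y" "x' + t' *\<^sub>R y"]
    by (simp add: F_def algebra_simps)
  have "p (x + x') \<le> p x + p x'" for x x'
  proof -
    have "p (x + x') - F x t \<le> p x'" if "0 \<le> t" for t
    proof (rule p_ge)
      fix t' :: real assume "0 \<le> t'"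
      then show "p (x + x') - F x t \<le> F x' t'"
        using p_le[of "t + t'" "x + x'"] F_add[of x x' t t'] that by simp
    qed
    then have "p (x + x') - p x' \<le> p x" by (intro p_ge) (simp add: algebra_simps)
    then show ?thesis by simp
  qed
  moreover have "p (a *\<^sub>R x) \<le> a * p x" if "0 \<le> a" for a x
  proof (cases "a = 0")
    case True
    then show ?thesis using p_le[of 0 0] sublinear_zero[OF q] by (simp add: F_def)
  next
    case False
    have "p (a *\<^sub>R x) / a \<le> p x"
    proof (rule p_ge)
      fix t :: real assume "0 \<le> t"
      \<comment> \<open>The parameter \<open>t\<close> at \<open>x\<close> corresponds to
        \<open>a * t\<close> at \<open>a *\<^sub>R x\<close>.\<close>
      then have "p (a *\<^sub>R x) \<le> F (a *\<^sub>R x) (a * t)" using that by (intro p_le) simp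
      also have "\<dots> \<le> a * F x t"
        using sublinear_scale_le[OF q that, of "x + t *\<^sub>R y"] by (simp add: F_def algebra_simps)
      finally show "p (a *\<^sub>R x) / a \<le> F x t" using that False by (simp add: field_simps)
    qed
    then show ?thesis using that False by (simp add: field_simps)
  qed
  ultimately have "sublinear p" by (simp add: sublinear_def)
  moreover have "p \<le> q" using p_le[of 0] by (auto simp: le_fun_def F_def)
  moreover have "p (- y) \<le> - q y" using p_le[of 1 "- y"] sublinear_zero[OF q] by (simp add: F_def)
  ultimately show thesis by (rule that)
qed

text \<open>The pointwise infimum works, with \<open>- p (- x)\<close> as lower bound. The chain
  condition makes it subadditive: of two members the smaller one can be used for both terms.\<close>

lemma sublinear_INF_chain:
  fixes C :: "('a::real_vector \<Rightarrow> real) set"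
  assumes "C \<noteq> {}" and sub: "\<And>q. q \<in> C \<Longrightarrow> sublinear q \<and> q \<le> p"
    and chain: "\<And>q q'. q \<in> C \<Longrightarrow> q' \<in> C \<Longrightarrow> q \<le> q' \<or> q' \<le> q"
  obtains m where "sublinear m" "\<And>q. q \<in> C \<Longrightarrow> m \<le> q"
proof -
  define m where "m x = (INF q\<in>C. q x)" for x
  have "- p (- x) \<le> q x" if "q \<in> C" for q x
    using sublinear_minus_le[of q x] sub[OF that] le_funD[of q p "- x"] by simp
  then have bdd: "bdd_below ((\<lambda>q. q x) ` C)" for x
    by (intro bdd_belowI[of _ "- p (- x)"]) auto
  have m_le: "m x \<le> q x" if "q \<in> C" for x q
    unfolding m_def using that by (intro cINF_lower[OF bdd])
  have m_ge: "c \<le> m x" if "\<And>q. q \<in> C \<Longrightarrow> c \<le> q x" for x c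
    unfolding m_def using that assms(1) by (intro cINF_greatest)
  have "m (x + y) \<le> m x + m y" for x y
  proof -
    have "m (x + y) - q x \<le> m y" if "q \<in> C" for q
    proof (rule m_ge)
      fix q' assume "q' \<in> C"
      with that chain obtain k where k: "k \<in> C" "k \<le> q" "k \<le> q'" by blast
      then show "m (x + y) - q x \<le> q' y"
        using m_le[of k "x + y"] sublinear_add[of k x y] sub[of k] le_funD[of k q x] le_funD[of k q' y]
        by simp
    qed
    then have "m (x + y) - m y \<le> m x" by (intro m_ge) (simp add: algebra_simps)
    then show ?thesis by simp
  qed
  moreover have "m (a *\<^sub>R x) \<le> a * m x" if "0 \<le> a" for a x
  proof (cases "a = 0")
    case True
    obtain q where "q \<in> C" using assms(1) by blast
    then show ?thesis using m_le[of q 0] sublinear_zero[of q] sub[of q] True by simp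
  next
    case False
    have "m (a *\<^sub>R x) / a \<le> m x"
    proof (rule m_ge)
      fix q assume "q \<in> C"
      then have "m (a *\<^sub>R x) \<le> a * q x"
        using m_le[of q "a *\<^sub>R x"] sublinear_scale_le[OF _ that, of q x] sub[of q] by simp
      then show "m (a *\<^sub>R x) / a \<le> q x" using that False by (simp add: field_simps)
    qed
    then show ?thesis using that False by (simp add: field_simps)
  qed
  ultimately have "sublinear m" by (simp add: sublinear_def)
  with m_le show thesis by (intro that) (auto simp: le_fun_def)
qed

lemma minimal_sublinear_below:
  fixes p :: "'a::real_vector \<Rightarrow> real"
  assumes "sublinear p"
  obtains m where "sublinear m" "m \<le> p" "\<And>q. sublinear q \<Longrightarrow> q \<le> m \<Longrightarrow> q = m"
proof -
  let ?A = "{q. sublinear q \<and> q \<le> p}"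
  \<comment> \<open>Zorn's lemma yields maximal elements, so the order is reversed to obtain a
    minimal one.\<close>
  have po: "partial_order_on ?A (relation_of (\<lambda>q q'. q' \<le> q) ?A)"
    by (rule partial_order_on_relation_ofI) auto
  have "\<exists>m\<in>?A. \<forall>q\<in>C. m \<le> q" if C: "C \<in> Chains (relation_of (\<lambda>q q'. q' \<le> q) ?A)" for C
  proof (cases "C = {}")
    case True
    with assms show ?thesis by auto
  next
    case False
    have 1: "sublinear q \<and> q \<le> p" if "q \<in> C" for q
      using C that by (auto simp: Chains_def relation_of_def)
    have 2: "q \<le> q' \<or> q' \<le> q" if "q \<in> C" "q' \<in> C" for q q'
      using C that by (auto simp: Chains_def relation_of_def)
    obtain m where m: "sublinear m" "\<And>q. q \<in> C \<Longrightarrow> m \<le> q"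
      using sublinear_INF_chain[OF False 1 2] by metis
    obtain q where "q \<in> C" using False by blast
    with m 1 have "m \<le> p" using order_trans by blast
    with m show ?thesis by blast
  qed
  from predicate_Zorn[OF po this]
  obtain m where m: "m \<in> ?A" "\<forall>q\<in>?A. q \<le> m \<longrightarrow> q = m" by blast
  show thesis
  proof (rule that)
    show "sublinear m" "m \<le> p" using m(1) by auto
    show "q = m" if "sublinear q" "q \<le> m" for q
      using m that order_trans[of q m p] by blast
  qed
qed

text \<open>The functional is a minimal sublinear functional below a decrease of the norm that already
  has the right value at \<open>x\<close>: minimality forces it to be odd, hence linear.\<close>

theorem Hahn_Banach_norming:
  fixes x :: "'a::real_normed_vector"
  obtains u where "linear u" "u x = norm x" "\<And>y. \<bar>u y\<bar> \<le> norm y"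
proof -
  have "sublinear (norm :: 'a \<Rightarrow> real)" by (auto simp: sublinear_def norm_triangle_ineq)
  then obtain p :: "'a \<Rightarrow> real"
    where p: "sublinear p" "p \<le> norm" "p (- x) \<le> - norm x"
    by (rule sublinear_decrease)
  then obtain u where u: "sublinear u" "u \<le> p"
    and min: "\<And>q. sublinear q \<Longrightarrow> q \<le> u \<Longrightarrow> q = u"
    using minimal_sublinear_below by blast
  have odd: "u (- y) = - u y" for y
  proof -
    \<comment> \<open>By minimality this \<open>q\<close> is \<open>u\<close> itself, which gives
      one half of oddness.\<close>
    obtain q where "sublinear q" "q \<le> u" "q (- y) \<le> - u y"
      using sublinear_decrease[OF u(1)] .
    then have "u (- y) \<le> - u y" using min by metis
    then show ?thesis using sublinear_minus_le[OF u(1), of y] by simp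
  qed
  have le: "u y \<le> norm y" for y
    using u(2) p(2) by (metis le_funD order_trans)
  have abs: "\<bar>u y\<bar> \<le> norm y" for y using le[of y] le[of "- y"] odd[of y] by simp
  \<comment> \<open>With oddness, subadditivity applied to \<open>y + z\<close> and
    \<open>- z\<close> gives the reverse inequality.\<close>
  have "u (y + z) = u y + u z" for y z
    using sublinear_add[OF u(1), of y z] sublinear_add[OF u(1), of "y + z" "- z"] odd[of z] by simp
  moreover have "u (t *\<^sub>R y) = t * u y" for t y
    using sublinear_scale[OF u(1), of t y] sublinear_scale[OF u(1), of "- t" y] odd[of "t *\<^sub>R y"]
    by (cases "0 \<le> t") auto
  ultimately have "linear u" by (intro linearI) auto
  moreover have "u x = norm x"
    using le_funD[OF u(2), of "- x"] p(3) odd[of x] le[of x] by simp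
  ultimately show thesis using abs by (rule that)
qed

section \<open>The scalar field and the unit balls of the duals\<close>

text \<open>The class axiom gives an isometric isomorphism that is not said to commute with
  \<open>of_real\<close>; the norm forces this. The complex case is then used only through
  \<open>J\<close>, the preimage of the imaginary unit, and through the bound of the real part by
  the modulus.\<close>

lemma real_or_complex_field_cases:
  obtains (real) "range (of_real :: real \<Rightarrow> 'k::real_or_complex_field) = UNIV"
  | (complex) J :: "'k::real_or_complex_field" where "J * J = - 1"
      "\<And>c. \<exists>a b. c = of_real a + of_real b * J" "\<And>a b. \<bar>a\<bar> \<le> norm (of_real a + of_real b * J)"
proof -
  \<comment> \<open>\<open>|w| = |t|\<close> and \<open>|w + 1| = |t + 1|\<close> leave only \<open>w = t\<close> in the complex plane.\<close>
  have of_real: "h (of_real t) = complex_of_real t"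
    if h: "inj h" "\<And>x y. h (x + y) = h x + h y" "\<And>x y. h (x * y) = h x * h y"
      "\<And>x. norm (h x) = norm x"
    for h :: "'k \<Rightarrow> complex" and t
  proof -
    have one: "h 1 = 1"
      using h(3)[of 1 1] h(4)[of 1] by (metis mult_cancel_right2 norm_one norm_zero zero_neq_one)
    define w where "w = h (of_real t)"
    have "norm w = \<bar>t\<bar>" by (simp add: w_def h(4))
    moreover have "norm (w + 1) = \<bar>t + 1\<bar>"
      unfolding w_def by (metis h(2,4) one norm_of_real of_real_1 of_real_add)
    ultimately have n: "(Re w)\<^sup>2 + (Im w)\<^sup>2 = t\<^sup>2" "(Re w + 1)\<^sup>2 + (Im w)\<^sup>2 = (t + 1)\<^sup>2"
      using cmod_power2[of w] cmod_power2[of "w + 1"] by simp_all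
    then have "Re w = t" by (simp add: power2_eq_square algebra_simps)
    with n(1) have "w = complex_of_real t" by (simp add: complex_eq_iff)
    then show ?thesis by (simp add: w_def)
  qed
  from isometric_iso_real_or_complex show thesis
  proof
    assume "\<exists>h::'k \<Rightarrow> real. bij h \<and> (\<forall>x y. h (x + y) = h x + h y) \<and>
        (\<forall>x y. h (x * y) = h x * h y) \<and> (\<forall>x. norm (h x) = norm x)"
    then obtain h :: "'k \<Rightarrow> real" where h: "bij h" "\<And>x y. h (x + y) = h x + h y"
      "\<And>x y. h (x * y) = h x * h y" "\<And>x. norm (h x) = norm x" by auto
    \<comment> \<open>Embedding the reals into the complex numbers lets the complex computation
      cover this case.\<close>
    have "complex_of_real (h (of_real t)) = complex_of_real t" for t
      using h by (intro of_real) (auto simp: inj_on_def bij_def)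
    then have "h (of_real (h c)) = h c" for c by simp
    then have "of_real (h c) = c" for c
      using h(1) by (metis bij_def injD)
    then show thesis using real by (metis surj_def)
  next
    assume "\<exists>h::'k \<Rightarrow> complex. bij h \<and> (\<forall>x y. h (x + y) = h x + h y) \<and>
        (\<forall>x y. h (x * y) = h x * h y) \<and> (\<forall>x. norm (h x) = norm x)"
    then obtain h :: "'k \<Rightarrow> complex" where h: "bij h" "\<And>x y. h (x + y) = h x + h y"
      "\<And>x y. h (x * y) = h x * h y" "\<And>x. norm (h x) = norm x" by auto
    have hr: "h (of_real t) = complex_of_real t" for t
      using h by (intro of_real) (auto simp: bij_def)
    obtain J where J: "h J = \<i>" using h(1) by (metis bij_def surj_def)
    have hJ: "h (of_real a + of_real b * J) = Complex a b" for a b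
      by (simp add: h(2,3) hr J complex_eq_iff)
    have inj: "x = y" if "h x = h y" for x y using that h(1) by (simp add: bij_def inj_eq)
    have "J * J = - 1" using h(3)[of J J] hr[of "-1"] J by (intro inj) simp
    moreover have "\<exists>a b. c = of_real a + of_real b * J" for c
      by (rule exI[of _ "Re (h c)"], rule exI[of _ "Im (h c)"], rule inj) (simp add: hJ)
    moreover have "\<bar>a\<bar> \<le> norm (of_real a + of_real b * J)" for a b
      using abs_Re_le_cmod[of "Complex a b"] h(4) hJ by (metis complex.sel(1))
    ultimately show thesis by (rule complex)
  qed
qed

text \<open>This is the closed unit ball of the dual. The pointwise bound can be checked without
  first establishing the boundedness that \<open>onorm\<close> relies on.\<close>

definition dual_ball :: "('k::real_normed_field \<Rightarrow> 'a::real_normed_vector \<Rightarrow> 'a) \<Rightarrow> ('a \<Rightarrow> 'k) set" where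
  "dual_ball s = {f. Vector_Spaces.linear s (*) f \<and> (\<forall>x. norm (f x) \<le> norm x)}"

context banach_space_over
begin

lemma linear_functionalI:
  assumes "\<And>x y. f (x + y) = f x + f y" "\<And>c x. f (s c x) = c * f x"
  shows "Vector_Spaces.linear s (*) f"
  using assms vector_space_axioms vector_space_mult by (simp add: Vector_Spaces.linear_iff)

text \<open>Losing a factor 2 avoids the rotation argument that bounds the complexification of a real
  functional sharply.\<close>

lemma dual_ball_norming:
  obtains f where "f \<in> dual_ball s" "norm x \<le> 2 * norm (f x)"
proof -
  obtain u where u: "linear u" "u x = norm x" "\<And>y. \<bar>u y\<bar> \<le> norm y"
    using Hahn_Banach_norming[of x] by blast
  note lin = linear_add[OF u(1)] linear_scale[OF u(1)] linear_neg[OF u(1)]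
  show thesis
  proof (cases rule: real_or_complex_field_cases[where ?'k = 'k])
    case real
    let ?f = "\<lambda>y. of_real (u y) :: 'k"
    have "Vector_Spaces.linear s (*) ?f"
    proof (rule linear_functionalI)
      fix c :: 'k and y
      obtain t where "c = of_real t" using real by blast
      then show "?f (s c y) = c * ?f y" by (simp add: scale_of_real lin)
    qed (simp add: lin)
    then have "?f \<in> dual_ball s" using u(3) by (simp add: dual_ball_def)
    then show thesis by (rule that) (simp add: u(2))
  next
    case (complex J)
    have "norm J * norm J = 1" by (metis complex(1) norm_minus_cancel norm_mult norm_one)
    then have J: "norm J = 1" by (metis abs_norm_cancel abs_mult_self_eq real_sqrt_abs2 real_sqrt_one)
    \<comment> \<open>Complexification: the second term makes \<open>?g\<close> commute with
      \<open>J\<close>. Both terms have norm at most \<open>norm y\<close>, hence the factor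
      \<open>1 / 2\<close> in \<open>?f\<close>.\<close>
    let ?g = "\<lambda>y. of_real (u y) - of_real (u (s J y)) * J"
    let ?f = "\<lambda>y. of_real (1 / 2) * ?g y"
    have add: "?g (y + z) = ?g y + ?g z" for y z by (simp add: lin scale_right_distrib algebra_simps)
    have real: "?g (s (of_real t) y) = of_real t * ?g y" for t y
    proof -
      have "s J (s (of_real t) y) = t *\<^sub>R s J y"
        by (metis mult.commute scale_scale scale_of_real)
      then show ?thesis by (simp add: lin scale_of_real algebra_simps)
    qed
    have imag: "?g (s J y) = J * ?g y" for y
    proof -
      have "s J (s J y) = - y" using complex(1) scale_scale[of J J y] by simp
      moreover have "J * (of_real (u (s J y)) * J) = of_real (u (s J y)) * (J * J)"
        by (simp only: mult.left_commute)
      ultimately show ?thesis by (simp add: lin complex(1) right_diff_distrib mult.commute)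
    qed
    have "Vector_Spaces.linear s (*) ?f"
    proof (rule linear_functionalI)
      show "?f (y + z) = ?f y + ?f z" for y z unfolding add by (simp add: algebra_simps)
      fix c :: 'k and y
      obtain a b where c: "c = of_real a + of_real b * J" using complex(2) by blast
      have "s c y = s (of_real a) y + s (of_real b) (s J y)" by (simp add: c scale_left_distrib)
      then have "?g (s c y) = c * ?g y"
        by (simp only: add real imag c) (simp add: algebra_simps)
      then show "?f (s c y) = c * ?f y" by simp
    qed
    moreover have "norm (?g y) \<le> 2 * norm y" for y
    proof -
      have "norm (?g y) \<le> \<bar>u y\<bar> + \<bar>u (s J y)\<bar>"
        by (rule order_trans[OF norm_triangle_ineq4]) (simp add: norm_mult J)
      then show ?thesis using u(3)[of y] u(3)[of "s J y"] norm_scale[of J y] J by simp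
    qed
    then have "norm (?f y) \<le> norm y" for y by (simp only: norm_mult norm_of_real) (simp add: mult.commute)
    ultimately have "?f \<in> dual_ball s" unfolding dual_ball_def by blast
    \<comment> \<open>The real part of \<open>?g x\<close> is \<open>u x = norm x\<close>, and the
      modulus dominates it.\<close>
    moreover have "norm x \<le> 2 * norm (?f x)"
      using complex(3)[of "u x" "- u (s J x)"] u(2) by (simp add: norm_mult)
    ultimately show thesis by (rule that)
  qed
qed

lemma dual_ball_eq_zeroI: "(\<And>f. f \<in> dual_ball s \<Longrightarrow> f x = 0) \<Longrightarrow> x = 0"
  by (metis dual_ball_norming mult_zero_right norm_le_zero_iff norm_zero)

lemma dual_ball_topological_dual:
  assumes "f \<in> dual_ball s"
  shows "f \<in> topological_dual s" "onorm f \<le> 1"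
proof -
  interpret f: Vector_Spaces.linear s "(*)" f using assms by (simp add: dual_ball_def)
  have b: "norm (f x) \<le> 1 * norm x" for x using assms by (simp add: dual_ball_def)
  have "f (t *\<^sub>R x) = t *\<^sub>R f x" for t x
    by (metis f.scale scale_of_real scaleR_conv_of_real)
  then have "bounded_linear f"
    using b by (intro bounded_linear_intro[of _ 1]) (auto simp: f.add)
  then show "f \<in> topological_dual s" using f.linear_axioms by (simp add: topological_dual_def)
  show "onorm f \<le> 1" using b by (rule onorm_bound[rotated]) simp
qed

end

section \<open>Slices and rank reduction\<close>

lemma linear_tensor_functional: "Vector_Spaces.linear scale_fun (*) (tensor_functional f g)"
  using vector_space_scale_fun vector_space_mult
  by (auto simp: Vector_Spaces.linear_iff scale_fun_def tensor_functional_def)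

text \<open>The universal property determines the map on \<open>tensor_space\<close> only;
  \<open>SOME\<close> picks one extension to the ambient function space.\<close>

definition tensor_lift ::
    "('k::field \<Rightarrow> 'a::ab_group_add \<Rightarrow> 'a) \<Rightarrow> ('k \<Rightarrow> 'b::ab_group_add \<Rightarrow> 'b) \<Rightarrow>
     ('k \<Rightarrow> 'c::ab_group_add \<Rightarrow> 'c) \<Rightarrow> ('a \<Rightarrow> 'b \<Rightarrow> 'c) \<Rightarrow> (('a \<Rightarrow> 'b \<Rightarrow> 'k) \<Rightarrow> 'k) \<Rightarrow> 'c" where
  "tensor_lift s1 s2 s3 \<phi> =
     (SOME L. Vector_Spaces.linear scale_fun s3 L \<and> (\<forall>x y. L (tensor s1 s2 x y) = \<phi> x y))"

lemma
  assumes "vector_space s3" "bilinear_map s1 s2 s3 \<phi>"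
  shows linear_tensor_lift: "Vector_Spaces.linear scale_fun s3 (tensor_lift s1 s2 s3 \<phi>)"
    and tensor_lift_tensor: "tensor_lift s1 s2 s3 \<phi> (tensor s1 s2 x y) = \<phi> x y"
proof -
  have "\<exists>L. Vector_Spaces.linear scale_fun s3 L \<and> (\<forall>x y. L (tensor s1 s2 x y) = \<phi> x y)"
    using tensor_universal_property[OF assms] by blast
  from someI_ex[OF this]
  show "Vector_Spaces.linear scale_fun s3 (tensor_lift s1 s2 s3 \<phi>)"
    "tensor_lift s1 s2 s3 \<phi> (tensor s1 s2 x y) = \<phi> x y"
    by (simp_all add: tensor_lift_def)
qed

section \<open>Sums of elementary tensors and their rank\<close>

locale tensor_product = X1: vector_space s1 + X2: vector_space s2
  for s1 :: "'k::field \<Rightarrow> 'a::ab_group_add \<Rightarrow> 'a" and s2 :: "'k \<Rightarrow> 'b::ab_group_add \<Rightarrow> 'b"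
begin

sublocale V: vector_space "scale_fun :: 'k \<Rightarrow> (('a \<Rightarrow> 'b \<Rightarrow> 'k) \<Rightarrow> 'k) \<Rightarrow> _"
  by (rule vector_space_scale_fun)

sublocale tensor_left: Vector_Spaces.linear s1 scale_fun "\<lambda>x. tensor s1 s2 x y"
  using bilinear_map_tensor[OF X1.vector_space_axioms X2.vector_space_axioms]
  by (simp add: bilinear_map_def)

sublocale tensor_right: Vector_Spaces.linear s2 scale_fun "tensor s1 s2 x"
  using bilinear_map_tensor[OF X1.vector_space_axioms X2.vector_space_axioms]
  by (simp add: bilinear_map_def)

lemma tensor_in_tensor_space: "tensor s1 s2 x y \<in> tensor_space s1 s2"
  unfolding tensor_space_def by (rule V.span_base) blast

lemma tensor_space_diff:
  "w \<in> tensor_space s1 s2 \<Longrightarrow> z \<in> tensor_space s1 s2 \<Longrightarrow> w - z \<in> tensor_space s1 s2"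
  unfolding tensor_space_def by (rule V.span_diff)

lemma sum_tensor_in_tensor_space: "(\<Sum>i\<in>I. tensor s1 s2 (x i) (y i)) \<in> tensor_space s1 s2"
  using tensor_in_tensor_space unfolding tensor_space_def by (rule V.span_sum)

text \<open>Coefficients of a linear combination are absorbed into the left factors. This also makes
  the set in the \<open>LEAST\<close> of \<open>tensor_rank\<close> nonempty.\<close>

lemma tensor_space_eq_sum:
  assumes "z \<in> tensor_space s1 s2"
  shows "\<exists>(n::nat) x y. z = (\<Sum>i<n. tensor s1 s2 (x i) (y i))"
  using assms unfolding tensor_space_def
proof (induction rule: V.span_induct_alt)
  case base
  show ?case by (rule exI[of _ 0]) simp
next
  case (step c t z)
  then obtain u v n x y where "t = tensor s1 s2 u v" "z = (\<Sum>i<n::nat. tensor s1 s2 (x i) (y i))"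
    by blast
  then have "scale_fun c t + z =
      (\<Sum>i<Suc n. tensor s1 s2 (if i < n then x i else s1 c u) (if i < n then y i else v))"
    by (simp add: tensor_left.scale add.commute)
  then show ?case by (intro exI[of _ "Suc n"] exI)
qed

text \<open>Allowing any finite index set lets later arguments delete or adjoin an index without
  renumbering.\<close>

lemma rank_le_tensorsI:
  fixes I :: "'i set"
  assumes "finite I" "card I \<le> r"
  shows "(\<Sum>i\<in>I. tensor s1 s2 (x i) (y i)) \<in> rank_le_tensors s1 s2 r"
proof -
  obtain h where h: "bij_betw h {0..<card I} I"
    using ex_bij_betw_nat_finite[OF assms(1)] by blast
  have "(\<Sum>i\<in>I. tensor s1 s2 (x i) (y i)) = (\<Sum>i<card I. tensor s1 s2 (x (h i)) (y (h i)))"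
    using sum.reindex_bij_betw[OF h, of "\<lambda>i. tensor s1 s2 (x i) (y i)"]
    by (simp add: atLeast0LessThan)
  then have "tensor_rank s1 s2 (\<Sum>i\<in>I. tensor s1 s2 (x i) (y i)) \<le> card I"
    unfolding tensor_rank_def
    by (intro Least_le exI[of _ "\<lambda>i. x (h i)"] exI[of _ "\<lambda>i. y (h i)"])
  with assms(2) show ?thesis by (simp add: rank_le_tensors_def sum_tensor_in_tensor_space)
qed

lemma rank_le_tensorsE:
  assumes "z \<in> rank_le_tensors s1 s2 r"
  obtains I :: "nat set" and x y
  where "finite I" "card I \<le> r" "z = (\<Sum>i\<in>I. tensor s1 s2 (x i) (y i))"
proof -
  have z: "z \<in> tensor_space s1 s2" "tensor_rank s1 s2 z \<le> r"
    using assms by (auto simp: rank_le_tensors_def)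
  have "\<exists>x y. z = (\<Sum>i<tensor_rank s1 s2 z. tensor s1 s2 (x i) (y i))"
    unfolding tensor_rank_def by (rule LeastI_ex) (rule tensor_space_eq_sum[OF z(1)])
  then show thesis using z(2) that[of "{..<tensor_rank s1 s2 z}"] by auto
qed

lemma rank_le_tensors_imp_tensor_space:
  "z \<in> rank_le_tensors s1 s2 r \<Longrightarrow> z \<in> tensor_space s1 s2"
  by (simp add: rank_le_tensors_def)

lemma rank_le_tensors_0: "z \<in> rank_le_tensors s1 s2 0 \<Longrightarrow> z = 0"
  by (erule rank_le_tensorsE) simp

lemma rank_le_tensors_add_tensor:
  assumes "z \<in> rank_le_tensors s1 s2 r"
  shows "z + tensor s1 s2 x y \<in> rank_le_tensors s1 s2 (Suc r)"
proof -
  obtain I :: "nat set" and u v where I: "finite I" "card I \<le> r"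
    "z = (\<Sum>i\<in>I. tensor s1 s2 (u i) (v i))"
    using assms by (rule rank_le_tensorsE)
  \<comment> \<open>\<open>None\<close> serves as a fresh index for the added tensor.\<close>
  let ?u = "case_option x u" and ?v = "case_option y v"
  have eq: "z + tensor s1 s2 x y = (\<Sum>i\<in>insert None (Some ` I). tensor s1 s2 (?u i) (?v i))"
    using I(1,3) by (simp add: sum.reindex add.commute)
  have "card (insert None (Some ` I)) \<le> Suc r"
    using I(1,2) by (simp add: card_image)
  then show ?thesis unfolding eq using I(1) by (intro rank_le_tensorsI) auto
qed

text \<open>Dividing the relation by \<open>b k\<close> and tensoring with \<open>y k\<close> gives
  a zero sum. Subtracting it from the given sum turns the right factor at \<open>k\<close> into
  \<open>0\<close>, and that summand disappears.\<close>

lemma sum_tensor_drop: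
  assumes "finite I" "k \<in> I" "b k \<noteq> 0" "(\<Sum>i\<in>I. s1 (b i) (x i)) = 0"
  shows "(\<Sum>i\<in>I. tensor s1 s2 (x i) (y i)) =
    (\<Sum>i\<in>I - {k}. tensor s1 s2 (x i) (y i - s2 (b i / b k) (y k)))"
proof -
  have "(\<Sum>i\<in>I. tensor s1 s2 (s1 (b i / b k) (x i)) (y k)) =
      tensor s1 s2 (s1 (1 / b k) (\<Sum>i\<in>I. s1 (b i) (x i))) (y k)"
    by (simp add: tensor_left.sum X1.scale_sum_right)
  also have "\<dots> = 0" by (simp add: assms(4) tensor_left.zero)
  finally have "(\<Sum>i\<in>I. tensor s1 s2 (x i) (y i)) =
      (\<Sum>i\<in>I. tensor s1 s2 (x i) (y i - s2 (b i / b k) (y k)))"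
    by (simp add: tensor_right.diff tensor_right.scale tensor_left.scale sum_subtractf)
  also have "\<dots> = (\<Sum>i\<in>I - {k}. tensor s1 s2 (x i) (y i - s2 (b i / b k) (y k)))"
    using assms by (simp add: sum.remove tensor_right.zero)
  finally show ?thesis .
qed

text \<open>The slices are \<open>id \<otimes> g\<close> and \<open>f \<otimes> id\<close>.\<close>

definition slice1 :: "('b \<Rightarrow> 'k) \<Rightarrow> (('a \<Rightarrow> 'b \<Rightarrow> 'k) \<Rightarrow> 'k) \<Rightarrow> 'a" where
  "slice1 g = tensor_lift s1 s2 s1 (\<lambda>x y. s1 (g y) x)"

definition slice2 :: "('a \<Rightarrow> 'k) \<Rightarrow> (('a \<Rightarrow> 'b \<Rightarrow> 'k) \<Rightarrow> 'k) \<Rightarrow> 'b" where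
  "slice2 f = tensor_lift s1 s2 s2 (\<lambda>x y. s2 (f x) y)"

lemma
  assumes "Vector_Spaces.linear s2 (*) g"
  shows linear_slice1: "Vector_Spaces.linear scale_fun s1 (slice1 g)"
    and slice1_tensor: "slice1 g (tensor s1 s2 x y) = s1 (g y) x"
proof -
  have "bilinear_map s1 s2 s1 (\<lambda>x y. s1 (g y) x)"
    using assms X1.vector_space_axioms
    by (auto simp: bilinear_map_def Vector_Spaces.linear_iff X1.scale_right_distrib
        X1.scale_left_distrib mult.commute)
  with X1.vector_space_axioms show "Vector_Spaces.linear scale_fun s1 (slice1 g)"
    "slice1 g (tensor s1 s2 x y) = s1 (g y) x"
    by (simp_all add: slice1_def linear_tensor_lift tensor_lift_tensor)
qed

lemma
  assumes "Vector_Spaces.linear s1 (*) f"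
  shows linear_slice2: "Vector_Spaces.linear scale_fun s2 (slice2 f)"
    and slice2_tensor: "slice2 f (tensor s1 s2 x y) = s2 (f x) y"
proof -
  have "bilinear_map s1 s2 s2 (\<lambda>x y. s2 (f x) y)"
    using assms X2.vector_space_axioms
    by (auto simp: bilinear_map_def Vector_Spaces.linear_iff X2.scale_right_distrib
        X2.scale_left_distrib mult.commute)
  with X2.vector_space_axioms show "Vector_Spaces.linear scale_fun s2 (slice2 f)"
    "slice2 f (tensor s1 s2 x y) = s2 (f x) y"
    by (simp_all add: slice2_def linear_tensor_lift tensor_lift_tensor)
qed

text \<open>Both sides are linear in \<open>z\<close> and agree on elementary tensors, which span
  the tensor space.\<close>

lemma
  assumes f: "Vector_Spaces.linear s1 (*) f" and g: "Vector_Spaces.linear s2 (*) g"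
    and z: "z \<in> tensor_space s1 s2"
  shows functional_slice1: "f (slice1 g z) = tensor_functional f g z"
    and functional_slice2: "g (slice2 f z) = tensor_functional f g z"
proof -
  interpret f: Vector_Spaces.linear s1 "(*)" f by (fact f)
  interpret g: Vector_Spaces.linear s2 "(*)" g by (fact g)
  note eq = vector_space_pair.linear_eq_on[OF vector_space_pair.intro
      [OF vector_space_scale_fun vector_space_mult] _ linear_tensor_functional
      z[unfolded tensor_space_def]]
  have 1: "Vector_Spaces.linear scale_fun (*) (\<lambda>z. f (slice1 g z))"
    using linear_slice1[OF g] f by (auto simp: Vector_Spaces.linear_iff)
  have 2: "Vector_Spaces.linear scale_fun (*) (\<lambda>z. g (slice2 f z))"
    using linear_slice2[OF f] g by (auto simp: Vector_Spaces.linear_iff)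
  show "f (slice1 g z) = tensor_functional f g z"
    by (rule eq[OF 1])
      (auto simp: slice1_tensor[OF g] tensor_functional_tensor[OF f g] f.scale)
  show "g (slice2 f z) = tensor_functional f g z"
    by (rule eq[OF 2])
      (auto simp: slice2_tensor[OF f] tensor_functional_tensor[OF f g] g.scale)
qed

text \<open>Subtracting changes each \<open>x i\<close> to \<open>x' i\<close> with \<open>\<Sum> g (y i) x' i = 0\<close>, a linear relation
  that eliminates one summand.\<close>

theorem rank_reduction:
  assumes z: "z \<in> rank_le_tensors s1 s2 (Suc r)"
    and f: "Vector_Spaces.linear s1 (*) f" and g: "Vector_Spaces.linear s2 (*) g"
    and c: "c = tensor_functional f g z" "c \<noteq> 0"
  shows "z - tensor s1 s2 (s1 (inverse c) (slice1 g z)) (slice2 f z) \<in> rank_le_tensors s1 s2 r"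
proof -
  interpret f: Vector_Spaces.linear s1 "(*)" f by (fact f)
  interpret g: Vector_Spaces.linear s2 "(*)" g by (fact g)
  interpret S: Vector_Spaces.linear scale_fun s1 "slice1 g" by (rule linear_slice1[OF g])
  interpret T: Vector_Spaces.linear scale_fun s2 "slice2 f" by (rule linear_slice2[OF f])
  obtain I :: "nat set" and x y where I: "finite I" "card I \<le> Suc r"
    and z_eq: "z = (\<Sum>i\<in>I. tensor s1 s2 (x i) (y i))"
    using z by (rule rank_le_tensorsE)
  define S where "S = slice1 g z"
  have S: "S = (\<Sum>i\<in>I. s1 (g (y i)) (x i))"
    by (simp add: S_def z_eq S.sum slice1_tensor[OF g])
  have T: "slice2 f z = (\<Sum>i\<in>I. s2 (f (x i)) (y i))"
    by (simp add: z_eq T.sum slice2_tensor[OF f])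
  have c_eq: "c = (\<Sum>i\<in>I. g (y i) * f (x i))"
    using functional_slice1[OF f g rank_le_tensors_imp_tensor_space[OF z]]
    by (simp add: c(1) S_def[symmetric] S f.sum f.scale)
  \<comment> \<open>As \<open>c\<close> is nonzero, some coefficient of the relation found below is
    nonzero; its index is the summand to eliminate.\<close>
  with c(2) obtain k where k: "k \<in> I" "g (y k) \<noteq> 0"
    by (metis (no_types, lifting) mult_eq_0_iff sum.neutral)
  define x' where "x' i = x i - s1 (f (x i) / c) S" for i
  \<comment> \<open>Expanding \<open>slice2 f z\<close> writes the subtracted tensor over the same
    right factors \<open>y i\<close>, so only the left factors change.\<close>
  have "tensor s1 s2 (s1 (inverse c) S) (slice2 f z) =
      (\<Sum>i\<in>I. tensor s1 s2 (s1 (f (x i) / c) S) (y i))"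
    by (simp add: T tensor_right.sum tensor_right.scale tensor_left.scale V.scale_sum_right
        divide_inverse mult.commute)
  then have "z - tensor s1 s2 (s1 (inverse c) S) (slice2 f z) =
      (\<Sum>i\<in>I. tensor s1 s2 (x' i) (y i))"
    by (simp add: z_eq x'_def tensor_left.diff sum_subtractf)
  \<comment> \<open>The coefficients of the second \<open>S\<close> add up to
    \<open>c / c = 1\<close>, so the two copies cancel.\<close>
  also have "(\<Sum>i\<in>I. s1 (g (y i)) (x' i)) = S - s1 (\<Sum>i\<in>I. g (y i) * f (x i) / c) S"
    by (simp add: x'_def X1.scale_right_diff_distrib sum_subtractf S[symmetric] X1.scale_sum_left)
  then have "(\<Sum>i\<in>I. s1 (g (y i)) (x' i)) = 0"
    using c(2) by (simp add: sum_divide_distrib[symmetric] c_eq[symmetric])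
  from sum_tensor_drop[OF I(1) k(1) _ this, of y] k(2)
  have "(\<Sum>i\<in>I. tensor s1 s2 (x' i) (y i)) =
      (\<Sum>i\<in>I - {k}. tensor s1 s2 (x' i) (y i - s2 (g (y i) / g (y k)) (y k)))" by simp
  also have "\<dots> \<in> rank_le_tensors s1 s2 r"
    using I k(1) by (intro rank_le_tensorsI) auto
  finally show ?thesis by (simp add: S_def)
qed

end

section \<open>Reasonable cross norms on tensors of bounded rank\<close>

lemma (in banach_space_over) tendsto_scale:
  assumes "(a \<longlongrightarrow> c) F" "(X \<longlongrightarrow> x) F"
  shows "((\<lambda>n. s (a n) (X n)) \<longlongrightarrow> s c x) F"
proof -
  have le: "norm (s (a n) (X n) - s c x) \<le>
      norm (a n - c) * norm (X n) + norm c * norm (X n - x)" for n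
  proof -
    have "s (a n) (X n) - s c x = s (a n - c) (X n) + s c (X n - x)"
      by (simp add: scale_left_diff_distrib scale_right_diff_distrib)
    then show ?thesis by (metis norm_scale norm_triangle_ineq)
  qed
  have "((\<lambda>n. norm (a n - c) * norm (X n) + norm c * norm (X n - x)) \<longlongrightarrow>
      norm (c - c) * norm x + norm c * norm (x - x)) F"
    by (intro tendsto_intros assms)
  then have "((\<lambda>n. norm (a n - c) * norm (X n) + norm c * norm (X n - x)) \<longlongrightarrow> 0) F" by simp
  with le have "((\<lambda>n. s (a n) (X n) - s c x) \<longlongrightarrow> 0) F"
    by (rule Lim_null_comparison[OF always_eventually[OF allI]])
  then show ?thesis by (rule LIM_zero_cancel)
qed

section \<open>Estimates between \<open>\<alpha>\<close> and the injective norm\<close>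

locale reasonable_cross_norm_pair =
  X1: banach_space_over s1 + X2: banach_space_over s2
  for s1 :: "'k::real_or_complex_field \<Rightarrow> 'a::banach \<Rightarrow> 'a"
    and s2 :: "'k \<Rightarrow> 'b::banach \<Rightarrow> 'b" +
  fixes \<alpha> :: "(('a \<Rightarrow> 'b \<Rightarrow> 'k) \<Rightarrow> 'k) \<Rightarrow> real"
  assumes reasonable: "reasonable_cross_norm s1 s2 \<alpha>"
begin

sublocale tensor_product s1 s2 ..

abbreviation TS where "TS \<equiv> tensor_space s1 s2"

lemma
  shows \<alpha>_nonneg: "z \<in> TS \<Longrightarrow> 0 \<le> \<alpha> z"
    and \<alpha>_eq_0_iff: "z \<in> TS \<Longrightarrow> \<alpha> z = 0 \<longleftrightarrow> z = 0"
    and \<alpha>_triangle: "w \<in> TS \<Longrightarrow> z \<in> TS \<Longrightarrow> \<alpha> (w + z) \<le> \<alpha> w + \<alpha> z"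
    and \<alpha>_scale: "z \<in> TS \<Longrightarrow> \<alpha> (scale_fun c z) = norm c * \<alpha> z"
    and \<alpha>_tensor_le: "\<alpha> (tensor s1 s2 x y) \<le> norm x * norm y"
  using reasonable by (simp_all add: reasonable_cross_norm_def norm_on_def)

lemma \<alpha>_minus_commute: "w \<in> TS \<Longrightarrow> z \<in> TS \<Longrightarrow> \<alpha> (w - z) = \<alpha> (z - w)"
  using \<alpha>_scale[of "z - w" "- 1"] V.scale_minus_left[of 1 "z - w"] by (simp add: tensor_space_diff)

lemma \<alpha>_triangle_diff:
  "u \<in> TS \<Longrightarrow> v \<in> TS \<Longrightarrow> w \<in> TS \<Longrightarrow> \<alpha> (u - w) \<le> \<alpha> (u - v) + \<alpha> (v - w)"
  using \<alpha>_triangle[of "u - v" "v - w"] by (simp add: tensor_space_diff)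

text \<open>Taken over both balls, this says that \<open>\<alpha>\<close> dominates the injective
  norm.\<close>

lemma norm_tensor_functional_le:
  assumes "f \<in> dual_ball s1" "g \<in> dual_ball s2" "z \<in> TS"
  shows "norm (tensor_functional f g z) \<le> \<alpha> z"
proof -
  note f = X1.dual_ball_topological_dual[OF assms(1)]
    and g = X2.dual_ball_topological_dual[OF assms(2)]
  have "norm (tensor_functional f g z) \<le> onorm f * onorm g * \<alpha> z"
    using reasonable f(1) g(1) assms(3) by (simp add: reasonable_cross_norm_def)
  also have "\<dots> \<le> 1 * 1 * \<alpha> z"
    using f g \<alpha>_nonneg[OF assms(3)]
    by (intro mult_mono) (auto simp: topological_dual_def onorm_pos_le)
  finally show ?thesis by simp
qed

text \<open>The factor 2 comes from \<open>dual_ball_norming\<close>. The bound \<open>e\<close> is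
  left open so that either the injective norm of \<open>z\<close> or \<open>\<alpha> z\<close> can
  be inserted.\<close>

lemma norm_slice1_le:
  assumes "g \<in> dual_ball s2" "z \<in> TS" "\<And>f. f \<in> dual_ball s1 \<Longrightarrow> norm (tensor_functional f g z) \<le> e"
  shows "norm (slice1 g z) \<le> 2 * e"
proof -
  obtain f where f: "f \<in> dual_ball s1" "norm (slice1 g z) \<le> 2 * norm (f (slice1 g z))"
    by (rule X1.dual_ball_norming)
  have "f (slice1 g z) = tensor_functional f g z"
    using f(1) assms(1,2) by (intro functional_slice1) (simp_all add: dual_ball_def)
  then show ?thesis using f assms(3)[of f] by simp
qed

lemma norm_slice2_le:
  assumes "f \<in> dual_ball s1" "z \<in> TS" "\<And>g. g \<in> dual_ball s2 \<Longrightarrow> norm (tensor_functional f g z) \<le> e"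
  shows "norm (slice2 f z) \<le> 2 * e"
proof -
  obtain g where g: "g \<in> dual_ball s2" "norm (slice2 f z) \<le> 2 * norm (g (slice2 f z))"
    by (rule X2.dual_ball_norming)
  have "g (slice2 f z) = tensor_functional f g z"
    using g(1) assms(1,2) by (intro functional_slice2) (simp_all add: dual_ball_def)
  then show ?thesis using g assms(3)[of g] by simp
qed

text \<open>This is definiteness of the injective norm. If all slices of a sum vanish, any
  \<open>g\<close> with \<open>g (y k) \<noteq> 0\<close> gives a relation among the left factors
  that drops a summand; by induction the sum is zero. Hence a nonzero \<open>z\<close> has a nonzero
  slice, which some \<open>f\<close> detects.\<close>

lemma tensor_functional_separating:
  assumes "z \<in> TS" "z \<noteq> 0"
  obtains f g where "f \<in> dual_ball s1" "g \<in> dual_ball s2" "tensor_functional f g z \<noteq> 0"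
proof -
  have "(\<Sum>i\<in>I. tensor s1 s2 (x i) (y i)) = 0"
    if "finite I" "\<And>g. g \<in> dual_ball s2 \<Longrightarrow> slice1 g (\<Sum>i\<in>I. tensor s1 s2 (x i) (y i)) = 0"
    for I :: "nat set" and x y
    using that
  proof (induction "card I" arbitrary: I y rule: less_induct)
    case less
    show ?case
    proof (cases "\<forall>i\<in>I. y i = 0")
      case True
      then show ?thesis by (simp add: tensor_right.zero)
    next
      case False
      then obtain k where k: "k \<in> I" "y k \<noteq> 0" by blast
      then obtain g where g: "g \<in> dual_ball s2" "g (y k) \<noteq> 0"
        using X2.dual_ball_eq_zeroI by blast
      then have lin: "Vector_Spaces.linear s2 (*) g" by (simp add: dual_ball_def)
      interpret S: Vector_Spaces.linear scale_fun s1 "slice1 g" by (rule linear_slice1[OF lin])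
      have "(\<Sum>i\<in>I. s1 (g (y i)) (x i)) = 0"
        using less.prems(2)[OF g(1)] by (simp add: S.sum slice1_tensor[OF lin])
      from sum_tensor_drop[OF less.prems(1) k(1) _ this] g(2)
      have eq: "(\<Sum>i\<in>I. tensor s1 s2 (x i) (y i)) =
          (\<Sum>i\<in>I - {k}. tensor s1 s2 (x i) (y i - s2 (g (y i) / g (y k)) (y k)))" by simp
      \<comment> \<open>The shorter sum is the same tensor, so its slices still vanish.\<close>
      show ?thesis
        unfolding eq
      proof (rule less.hyps)
        show "card (I - {k}) < card I" using less.prems(1) k(1) by (rule card_Diff1_less)
      qed (use less.prems in \<open>simp_all add: eq\<close>)
    qed
  qed
  moreover obtain I :: "nat set" and x y where "finite I" "z = (\<Sum>i\<in>I. tensor s1 s2 (x i) (y i))"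
    using tensor_space_eq_sum[OF assms(1)] by blast
  ultimately obtain g where g: "g \<in> dual_ball s2" "slice1 g z \<noteq> 0"
    using assms(2) by blast
  then obtain f where "f \<in> dual_ball s1" "f (slice1 g z) \<noteq> 0"
    using X1.dual_ball_eq_zeroI by blast
  with g assms(1) show thesis
    using functional_slice1[of f g z] by (intro that[of f g]) (auto simp: dual_ball_def)
qed

text \<open>Let \<open>m\<close> be the injective norm of \<open>z\<close>. The subtracted tensor
  \<open>t\<close> has \<open>\<alpha> t \<le> 8 * m\<close>, so the injective norm of
  \<open>z - t\<close> is at most \<open>9 * m\<close>. The constants fit because
  \<open>(9 ^ r - 1) * 9 + 8 = 9 ^ Suc r - 1\<close>.\<close>

theorem \<alpha>_le_injective_bound:
  assumes "z \<in> rank_le_tensors s1 s2 r"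
    and "\<And>f g. f \<in> dual_ball s1 \<Longrightarrow> g \<in> dual_ball s2 \<Longrightarrow> norm (tensor_functional f g z) \<le> e"
  shows "\<alpha> z \<le> (9 ^ r - 1) * e"
  using assms
proof (induction r arbitrary: z e)
  case 0
  then have "z \<in> TS" "z = 0"
    using rank_le_tensors_imp_tensor_space rank_le_tensors_0 by blast+
  then have "\<alpha> z = 0" using \<alpha>_eq_0_iff by blast
  then show ?case by simp
next
  case (Suc r)
  have z: "z \<in> TS" using Suc.prems(1) by (rule rank_le_tensors_imp_tensor_space)
  \<comment> \<open>Nonempty balls give \<open>0 \<le> e\<close> and, later, a nonempty set for the
    supremum.\<close>
  obtain f0 where f0: "f0 \<in> dual_ball s1" using X1.dual_ball_norming[of 0] by blast
  obtain g0 where g0: "g0 \<in> dual_ball s2" using X2.dual_ball_norming[of 0] by blast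
  note fg0 = f0 g0
  have e: "0 \<le> e" using Suc.prems(2)[OF fg0] norm_ge_zero order_trans by blast
  have pow: "(1::real) \<le> 9 ^ Suc r" by (rule one_le_power) simp
  show ?case
  proof (cases "z = 0")
    case True
    then have "\<alpha> z = 0" using \<alpha>_eq_0_iff[OF z] by blast
    then show ?thesis using e pow by (metis diff_ge_0_iff_ge mult_nonneg_nonneg)
  next
    case False
    \<comment> \<open>The supremum \<open>m\<close> replaces \<open>e\<close> because the pair
      chosen below has to attain more than half of the bound; \<open>z \<noteq> 0\<close> makes
      \<open>m\<close> positive.\<close>
    define E where "E = (\<lambda>(f, g). norm (tensor_functional f g z)) ` (dual_ball s1 \<times> dual_ball s2)"
    define m where "m = Sup E"
    have E: "norm (tensor_functional f g z) \<in> E" if "f \<in> dual_ball s1" "g \<in> dual_ball s2" for f g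
      using that by (force simp: E_def)
    have bdd: "bdd_above E" using Suc.prems(2) by (intro bdd_aboveI[of _ e]) (auto simp: E_def)
    have le_m: "norm (tensor_functional f g z) \<le> m" if "f \<in> dual_ball s1" "g \<in> dual_ball s2" for f g
      unfolding m_def using E[OF that] bdd by (rule cSup_upper)
    have "m \<le> e"
      unfolding m_def using Suc.prems(2) E[OF fg0] by (intro cSup_least) (auto simp: E_def)
    obtain f1 g1 where "f1 \<in> dual_ball s1" "g1 \<in> dual_ball s2" "tensor_functional f1 g1 z \<noteq> 0"
      using tensor_functional_separating[OF z False] by blast
    then have "0 < m" using le_m[of f1 g1] order_less_le_trans zero_less_norm_iff by blast
    then have "m / 2 < Sup E" by (simp add: m_def)
    then obtain v where "v \<in> E" "m / 2 < v"
      using less_cSupD[of E "m / 2"] E[OF fg0] by blast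
    then obtain f g where f: "f \<in> dual_ball s1" and g: "g \<in> dual_ball s2"
      and c_gt: "m / 2 < norm (tensor_functional f g z)"
      by (auto simp: E_def)
    define c where "c = tensor_functional f g z"
    define t where "t = tensor s1 s2 (s1 (inverse c) (slice1 g z)) (slice2 f z)"
    have t: "t \<in> TS" unfolding t_def by (rule tensor_in_tensor_space)
    have c: "m / 2 < norm c" "c \<noteq> 0" using c_gt \<open>0 < m\<close> by (auto simp: c_def)
    \<comment> \<open>The two slice bounds \<open>2 * m\<close> and the lower bound
      \<open>m / 2\<close> for \<open>norm c\<close> produce the constant 8.\<close>
    have "norm (slice1 g z) \<le> 2 * m" "norm (slice2 f z) \<le> 2 * m"
      using norm_slice1_le[OF g z] norm_slice2_le[OF f z] le_m f g by blast+
    moreover have "\<alpha> t \<le> inverse (norm c) * norm (slice1 g z) * norm (slice2 f z)"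
      unfolding t_def by (rule order_trans[OF \<alpha>_tensor_le]) (simp add: X1.norm_scale norm_inverse)
    moreover have "inverse (norm c) \<le> 2 / m"
      using c \<open>0 < m\<close> by (simp add: field_simps)
    moreover have "inverse (norm c) * norm (slice1 g z) * norm (slice2 f z) \<le>
        (2 / m) * (2 * m) * (2 * m)"
      using calculation \<open>0 < m\<close> by (intro mult_mono) auto
    ultimately have "\<alpha> t \<le> (2 / m) * (2 * m) * (2 * m)" by linarith
    then have \<alpha>t: "\<alpha> t \<le> 8 * m" using \<open>0 < m\<close> by simp
    have "z - t \<in> rank_le_tensors s1 s2 r"
      unfolding t_def using Suc.prems(1) f g c(2)
      by (intro rank_reduction) (auto simp: dual_ball_def c_def)
    moreover have "norm (tensor_functional f' g' (z - t)) \<le> 9 * m"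
      if "f' \<in> dual_ball s1" "g' \<in> dual_ball s2" for f' g'
    proof -
      interpret tf: Vector_Spaces.linear scale_fun "(*)" "tensor_functional f' g'"
        by (rule linear_tensor_functional)
      show ?thesis
        using norm_triangle_ineq4[of "tensor_functional f' g' z" "tensor_functional f' g' t"]
          le_m[OF that] norm_tensor_functional_le[OF that t] \<alpha>t by (simp add: tf.diff)
    qed
    ultimately have "\<alpha> (z - t) \<le> (9 ^ r - 1) * (9 * m)" by (rule Suc.IH)
    then have "\<alpha> z \<le> (9 ^ Suc r - 1) * m"
      using \<alpha>_triangle[OF tensor_space_diff[OF z t] t] \<alpha>t by (simp add: algebra_simps)
    also have "\<dots> \<le> (9 ^ Suc r - 1) * e"
      using \<open>m \<le> e\<close> pow by (intro mult_left_mono) simp_all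
    finally show ?thesis .
  qed
qed

section \<open>Convergence of sequences of bounded rank\<close>

lemma tensor_tendsto:
  assumes "X \<longlonglongrightarrow> x" "Y \<longlonglongrightarrow> y"
  shows "(\<lambda>n. \<alpha> (tensor s1 s2 (X n) (Y n) - tensor s1 s2 x y)) \<longlonglongrightarrow> 0"
proof -
  have "\<alpha> (tensor s1 s2 (X n) (Y n) - tensor s1 s2 x y) \<le>
      norm (X n - x) * norm (Y n) + norm x * norm (Y n - y)" for n
  proof -
    \<comment> \<open>One factor is changed at a time.\<close>
    have "tensor s1 s2 (X n) (Y n) - tensor s1 s2 x y =
        tensor s1 s2 (X n - x) (Y n) + tensor s1 s2 x (Y n - y)"
      by (simp add: tensor_left.diff tensor_right.diff)
    then show ?thesis
      using \<alpha>_triangle[OF tensor_in_tensor_space tensor_in_tensor_space, of "X n - x" "Y n" x "Y n - y"]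
        \<alpha>_tensor_le[of "X n - x" "Y n"] \<alpha>_tensor_le[of x "Y n - y"] by simp
  qed
  then have le: "norm (\<alpha> (tensor s1 s2 (X n) (Y n) - tensor s1 s2 x y)) \<le>
      norm (X n - x) * norm (Y n) + norm x * norm (Y n - y)" for n
    using \<alpha>_nonneg[OF tensor_space_diff[OF tensor_in_tensor_space tensor_in_tensor_space]] by simp
  have "(\<lambda>n. norm (X n - x) * norm (Y n) + norm x * norm (Y n - y)) \<longlonglongrightarrow>
      norm (x - x) * norm y + norm x * norm (y - y)"
    by (intro tendsto_intros assms)
  then have "(\<lambda>n. norm (X n - x) * norm (Y n) + norm x * norm (Y n - y)) \<longlonglongrightarrow> 0" by simp
  then show ?thesis by (rule Lim_null_comparison[OF always_eventually[OF allI[OF le]]])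
qed

text \<open>\<open>\<alpha>\<close> is a norm only on the subset \<open>TS\<close> of the function
  type, so the Cauchy property is spelled out instead of taken from a type class.\<close>

definition \<alpha>_Cauchy :: "(nat \<Rightarrow> (('a \<Rightarrow> 'b \<Rightarrow> 'k) \<Rightarrow> 'k)) \<Rightarrow> bool" where
  "\<alpha>_Cauchy Z \<longleftrightarrow> (\<forall>e>0. \<exists>N. \<forall>m\<ge>N. \<forall>n\<ge>N. \<alpha> (Z m - Z n) < e)"

lemma \<alpha>_Cauchy_shift: "\<alpha>_Cauchy Z \<Longrightarrow> \<alpha>_Cauchy (\<lambda>n. Z (n + k))"
  unfolding \<alpha>_Cauchy_def by (meson trans_le_add1)

lemma \<alpha>_Cauchy_diff_convergent:
  assumes "\<alpha>_Cauchy Z" "(\<lambda>n. \<alpha> (W n - w)) \<longlonglongrightarrow> 0"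
    and TS: "\<And>n. Z n \<in> TS" "\<And>n. W n \<in> TS" "w \<in> TS"
  shows "\<alpha>_Cauchy (\<lambda>n. Z n - W n)"
  unfolding \<alpha>_Cauchy_def
proof (intro allI impI)
  fix e :: real assume "0 < e"
  then have e: "0 < e / 3" by simp
  obtain N where N: "\<And>m n. m \<ge> N \<Longrightarrow> n \<ge> N \<Longrightarrow> \<alpha> (Z m - Z n) < e / 3"
    using assms(1) e unfolding \<alpha>_Cauchy_def by blast
  obtain M where M: "\<And>n. n \<ge> M \<Longrightarrow> \<alpha> (W n - w) < e / 3"
    using order_tendstoD(2)[OF assms(2) e] unfolding eventually_sequentially by blast
  have "\<alpha> ((Z m - W m) - (Z n - W n)) < e" if "m \<ge> max N M" "n \<ge> max N M" for m n
  proof -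
    have eq: "(Z m - W m) - (Z n - W n) = (Z m - Z n) + (W n - W m)" by simp
    have "\<alpha> ((Z m - W m) - (Z n - W n)) \<le> \<alpha> (Z m - Z n) + (\<alpha> (W n - w) + \<alpha> (w - W m))"
      unfolding eq using \<alpha>_triangle[of "Z m - Z n" "W n - W m"] \<alpha>_triangle_diff[of "W n" w "W m"] TS
      by (simp add: tensor_space_diff)
    moreover have "\<alpha> (w - W m) = \<alpha> (W m - w)" using TS by (intro \<alpha>_minus_commute)
    moreover have "\<alpha> (Z m - Z n) < e / 3" "\<alpha> (W m - w) < e / 3" "\<alpha> (W n - w) < e / 3"
      using that by (intro N M; simp)+
    ultimately show ?thesis by linarith
  qed
  then show "\<exists>N. \<forall>m\<ge>N. \<forall>n\<ge>N. \<alpha> (Z m - W m - (Z n - W n)) < e" by blast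
qed

text \<open>The slice bounds with \<open>e = \<alpha> (Z m - Z n)\<close> make both slices Lipschitz
  with constant 2 for \<open>\<alpha>\<close>.\<close>

lemma Cauchy_slices:
  assumes "\<alpha>_Cauchy Z" "\<And>n. Z n \<in> TS" and f: "f \<in> dual_ball s1" and g: "g \<in> dual_ball s2"
  shows "Cauchy (\<lambda>n. slice1 g (Z n))" "Cauchy (\<lambda>n. slice2 f (Z n))"
proof -
  interpret S: Vector_Spaces.linear scale_fun s1 "slice1 g"
    using g by (intro linear_slice1) (simp add: dual_ball_def)
  interpret T: Vector_Spaces.linear scale_fun s2 "slice2 f"
    using f by (intro linear_slice2) (simp add: dual_ball_def)
  have TS: "Z m - Z n \<in> TS" for m n using assms(2) by (intro tensor_space_diff)
  have le: "norm (slice1 g (Z m) - slice1 g (Z n)) \<le> 2 * \<alpha> (Z m - Z n)"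
    "norm (slice2 f (Z m) - slice2 f (Z n)) \<le> 2 * \<alpha> (Z m - Z n)" for m n
    using norm_slice1_le[OF g TS norm_tensor_functional_le[OF _ g TS]]
      norm_slice2_le[OF f TS norm_tensor_functional_le[OF f _ TS]]
    by (simp_all add: S.diff T.diff)
  have "\<exists>N. \<forall>m\<ge>N. \<forall>n\<ge>N. norm (slice1 g (Z m) - slice1 g (Z n)) < e \<and>
      norm (slice2 f (Z m) - slice2 f (Z n)) < e" if e: "0 < e" for e :: real
  proof -
    obtain N where N: "\<And>m n. m \<ge> N \<Longrightarrow> n \<ge> N \<Longrightarrow> \<alpha> (Z m - Z n) < e / 2"
      using assms(1) half_gt_zero[OF e] unfolding \<alpha>_Cauchy_def by blast
    have "norm (slice1 g (Z m) - slice1 g (Z n)) < e \<and> norm (slice2 f (Z m) - slice2 f (Z n)) < e"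
      if "m \<ge> N" "n \<ge> N" for m n
      using le[of m n] N[OF that] by linarith
    then show ?thesis by blast
  qed
  then show "Cauchy (\<lambda>n. slice1 g (Z n))" "Cauchy (\<lambda>n. slice2 f (Z n))"
    unfolding Cauchy_iff by blast+
qed

text \<open>The Cauchy property makes the null limits uniform over both balls: in the bound for
  \<open>Z n - Z m\<close>, \<open>m\<close> tends to infinity while \<open>n\<close> is fixed. Then
  \<open>\<alpha>_le_injective_bound\<close> applies.\<close>

lemma \<alpha>_Cauchy_weakly_null:
  assumes Z: "\<And>n. Z n \<in> rank_le_tensors s1 s2 r" "\<alpha>_Cauchy Z"
    and null: "\<And>f g. f \<in> dual_ball s1 \<Longrightarrow> g \<in> dual_ball s2 \<Longrightarrow>
      (\<lambda>n. tensor_functional f g (Z n)) \<longlonglongrightarrow> 0"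
  shows "(\<lambda>n. \<alpha> (Z n)) \<longlonglongrightarrow> 0"
proof (rule LIMSEQ_I)
  fix e :: real assume "0 < e"
  have TS: "Z n \<in> TS" for n using Z(1) by (rule rank_le_tensors_imp_tensor_space)
  \<comment> \<open>With this choice the factor \<open>9 ^ r - 1\<close> of the injective bound
    leads to a value strictly below \<open>e\<close>.\<close>
  let ?d = "e / 9 ^ r"
  have "0 < ?d" using \<open>0 < e\<close> by simp
  then obtain N where N: "\<And>m n. m \<ge> N \<Longrightarrow> n \<ge> N \<Longrightarrow> \<alpha> (Z m - Z n) < ?d"
    using Z(2) unfolding \<alpha>_Cauchy_def by blast
  have "norm (\<alpha> (Z n) - 0) < e" if n: "n \<ge> N" for n
  proof -
    have "norm (tensor_functional f g (Z n)) \<le> ?d"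
      if fg: "f \<in> dual_ball s1" "g \<in> dual_ball s2" for f g
    proof -
      interpret tf: Vector_Spaces.linear scale_fun "(*)" "tensor_functional f g"
        by (rule linear_tensor_functional)
      have "norm (tensor_functional f g (Z n) - tensor_functional f g (Z m)) \<le> ?d" if "m \<ge> N" for m
        using norm_tensor_functional_le[OF fg tensor_space_diff[OF TS TS], of n m] N[OF n that]
        by (simp add: tf.diff)
      moreover have "(\<lambda>m. norm (tensor_functional f g (Z n) - tensor_functional f g (Z m)))
          \<longlonglongrightarrow> norm (tensor_functional f g (Z n) - 0)"
        by (intro tendsto_intros null[OF fg])
      ultimately have "norm (tensor_functional f g (Z n) - 0) \<le> ?d"
        by (intro LIMSEQ_le_const2) auto
      then show ?thesis by simp
    qed
    then have "\<alpha> (Z n) \<le> (9 ^ r - 1) * ?d" by (intro \<alpha>_le_injective_bound[OF Z(1)])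
    also have "\<dots> < 9 ^ r * ?d" using \<open>0 < ?d\<close> by (intro mult_strict_right_mono) auto
    also have "\<dots> = e" by simp
    finally show ?thesis using \<alpha>_nonneg[OF TS] by simp
  qed
  then show "\<exists>N. \<forall>n\<ge>N. norm (\<alpha> (Z n) - 0) < e" by blast
qed

theorem \<alpha>_Cauchy_convergent:
  assumes "\<And>n. Z n \<in> rank_le_tensors s1 s2 r" "\<alpha>_Cauchy Z"
  shows "\<exists>z\<in>rank_le_tensors s1 s2 r. (\<lambda>n. \<alpha> (Z n - z)) \<longlonglongrightarrow> 0"
  using assms
proof (induction r arbitrary: Z)
  case 0
  then have "Z n = 0" for n by (intro rank_le_tensors_0)
  then have "\<alpha> (Z n - Z 0) = 0" for n
    using \<alpha>_eq_0_iff[of "Z n - Z 0"] 0(1) by (metis diff_self rank_le_tensors_imp_tensor_space)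
  then have "(\<lambda>n. \<alpha> (Z n - Z 0)) \<longlonglongrightarrow> 0" by (simp only: tendsto_const)
  then show ?case using 0(1) by blast
next
  case (Suc r)
  have TS: "Z n \<in> TS" for n using Suc.prems(1) by (rule rank_le_tensors_imp_tensor_space)
  show ?case
  proof (cases "\<forall>f\<in>dual_ball s1. \<forall>g\<in>dual_ball s2. (\<lambda>n. tensor_functional f g (Z n)) \<longlonglongrightarrow> 0")
    case True
    then have "(\<lambda>n. \<alpha> (Z n - 0)) \<longlonglongrightarrow> 0"
      unfolding diff_0_right by (intro \<alpha>_Cauchy_weakly_null[OF Suc.prems]) blast
    moreover have "0 \<in> rank_le_tensors s1 s2 (Suc r)"
      using rank_le_tensorsI[of "{}" "Suc r" "\<lambda>_. 0" "\<lambda>_. 0"] by simp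
    ultimately show ?thesis by blast
  next
    case False
    then obtain f g where f: "f \<in> dual_ball s1" and g: "g \<in> dual_ball s2"
      and not_null: "\<not> (\<lambda>n. tensor_functional f g (Z n)) \<longlonglongrightarrow> 0" by blast
    have lin: "Vector_Spaces.linear s1 (*) f" "Vector_Spaces.linear s2 (*) g"
      using f g by (simp_all add: dual_ball_def)
    define c where "c n = tensor_functional f g (Z n)" for n
    obtain x where x: "(\<lambda>n. slice1 g (Z n)) \<longlonglongrightarrow> x"
      using Cauchy_slices(1)[OF Suc.prems(2) TS f g] Cauchy_convergent convergentD by blast
    obtain y where y: "(\<lambda>n. slice2 f (Z n)) \<longlonglongrightarrow> y"
      using Cauchy_slices(2)[OF Suc.prems(2) TS f g] Cauchy_convergent convergentD by blast
    have "bounded_linear f"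
      using X1.dual_ball_topological_dual(1)[OF f] by (simp add: topological_dual_def)
    \<comment> \<open>\<open>c n\<close> is \<open>f\<close> of a convergent slice, so it converges
      in any case; not being null, it has the nonzero limit \<open>f x\<close>.\<close>
    from bounded_linear.tendsto[OF this x] have c_lim: "c \<longlonglongrightarrow> f x"
      by (simp add: functional_slice1[OF lin TS] c_def[abs_def])
    with not_null have "f x \<noteq> 0" by (auto simp: c_def[abs_def])
    \<comment> \<open>Rank reduction applies only from \<open>k\<close> on, whence the shift by
      \<open>k\<close> below.\<close>
    then obtain k where c_nz: "\<And>n. n \<ge> k \<Longrightarrow> c n \<noteq> 0"
      using tendsto_imp_eventually_ne[OF c_lim] by (auto simp: eventually_sequentially)
    define W where "W n = tensor s1 s2 (s1 (inverse (c n)) (slice1 g (Z n))) (slice2 f (Z n))" for n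
    define w where "w = tensor s1 s2 (s1 (inverse (f x)) x) y"
    have W_TS: "W n \<in> TS" "w \<in> TS" for n by (simp_all add: W_def w_def tensor_in_tensor_space)
    have W_lim: "(\<lambda>n. \<alpha> (W n - w)) \<longlonglongrightarrow> 0"
      unfolding W_def w_def using \<open>f x \<noteq> 0\<close>
      by (intro tensor_tendsto X1.tendsto_scale tendsto_inverse c_lim x y)
    have "\<alpha>_Cauchy (\<lambda>n. Z (n + k) - W (n + k))"
      using \<alpha>_Cauchy_shift[OF \<alpha>_Cauchy_diff_convergent[OF Suc.prems(2) W_lim TS W_TS]] .
    moreover have "Z (n + k) - W (n + k) \<in> rank_le_tensors s1 s2 r" for n
      unfolding W_def by (rule rank_reduction[OF Suc.prems(1) lin]) (simp_all add: c_def[symmetric] c_nz)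
    ultimately obtain v where v: "v \<in> rank_le_tensors s1 s2 r"
      "(\<lambda>n. \<alpha> (Z (n + k) - W (n + k) - v)) \<longlonglongrightarrow> 0"
      using Suc.IH[of "\<lambda>n. Z (n + k) - W (n + k)"] by blast
    have v_TS: "v \<in> TS" using v(1) by (rule rank_le_tensors_imp_tensor_space)
    have vw: "v + w \<in> rank_le_tensors s1 s2 (Suc r)"
      unfolding w_def using v(1) by (rule rank_le_tensors_add_tensor)
    have lim: "(\<lambda>n. \<alpha> (Z (n + k) - W (n + k) - v) + \<alpha> (W (n + k) - w)) \<longlonglongrightarrow> 0"
      using tendsto_add[OF v(2) LIMSEQ_ignore_initial_segment[OF W_lim, of k]] by simp
    have le: "norm (\<alpha> (Z (n + k) - (v + w))) \<le>
        \<alpha> (Z (n + k) - W (n + k) - v) + \<alpha> (W (n + k) - w)" for n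
    proof -
      have eq: "Z (n + k) - (v + w) = (Z (n + k) - W (n + k) - v) + (W (n + k) - w)" by simp
      have "Z (n + k) - (v + w) \<in> TS"
        using TS rank_le_tensors_imp_tensor_space[OF vw] by (intro tensor_space_diff)
      then have "norm (\<alpha> (Z (n + k) - (v + w))) = \<alpha> (Z (n + k) - (v + w))"
        using \<alpha>_nonneg by simp
      also have "\<dots> \<le> \<alpha> (Z (n + k) - W (n + k) - v) + \<alpha> (W (n + k) - w)"
        unfolding eq using TS W_TS v_TS by (intro \<alpha>_triangle tensor_space_diff)
      finally show ?thesis .
    qed
    from le lim have "(\<lambda>n. \<alpha> (Z (n + k) - (v + w))) \<longlonglongrightarrow> 0"
      by (rule Lim_null_comparison[OF always_eventually[OF allI]])
    then have "(\<lambda>n. \<alpha> (Z n - (v + w))) \<longlonglongrightarrow> 0" by (rule LIMSEQ_offset)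
    with vw show ?thesis by blast
  qed
qed

end

section \<open>Completeness of the metric space\<close>

theorem proposition2p10:
  fixes s1 :: "'k::real_or_complex_field \<Rightarrow> 'a::banach \<Rightarrow> 'a"
    and s2 :: "'k \<Rightarrow> 'b::banach \<Rightarrow> 'b"
    and \<alpha> :: "(('a \<Rightarrow> 'b \<Rightarrow> 'k) \<Rightarrow> 'k) \<Rightarrow> real"
    and r :: nat
  assumes "banach_space_over s1"
    and "banach_space_over s2"
    and "reasonable_cross_norm s1 s2 \<alpha>"
    and "r \<ge> 1"
  shows "Metric_space (rank_le_tensors s1 s2 r) (tensor_dist s1 s2 \<alpha>) \<and>
    Metric_space.mcomplete (rank_le_tensors s1 s2 r) (tensor_dist s1 s2 \<alpha>)"
proof -
  interpret reasonable_cross_norm_pair s1 s2 \<alpha>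
    using assms(1-3)
    by (intro reasonable_cross_norm_pair.intro reasonable_cross_norm_pair_axioms.intro)
  \<comment> \<open>The default value of \<open>tensor_dist\<close> never occurs on tensors of
    bounded rank, so the metric notions unfold to those for \<open>\<alpha>\<close>.\<close>
  have dist: "tensor_dist s1 s2 \<alpha> w z = \<alpha> (w - z)"
    if "w \<in> rank_le_tensors s1 s2 r" "z \<in> rank_le_tensors s1 s2 r" for w z
    using that by (simp add: tensor_dist_def rank_le_tensors_imp_tensor_space)
  interpret M: Metric_space "rank_le_tensors s1 s2 r" "tensor_dist s1 s2 \<alpha>"
  proof
    show "0 \<le> tensor_dist s1 s2 \<alpha> x y" for x y
      by (simp add: tensor_dist_def \<alpha>_nonneg tensor_space_diff)
    show "tensor_dist s1 s2 \<alpha> x y = tensor_dist s1 s2 \<alpha> y x" for x y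
      using \<alpha>_minus_commute[of x y] by (simp add: tensor_dist_def)
    show "tensor_dist s1 s2 \<alpha> x y = 0 \<longleftrightarrow> x = y"
      if "x \<in> rank_le_tensors s1 s2 r" "y \<in> rank_le_tensors s1 s2 r" for x y
      using that by (simp add: dist \<alpha>_eq_0_iff tensor_space_diff rank_le_tensors_imp_tensor_space)
    show "tensor_dist s1 s2 \<alpha> x z \<le> tensor_dist s1 s2 \<alpha> x y + tensor_dist s1 s2 \<alpha> y z"
      if "x \<in> rank_le_tensors s1 s2 r" "y \<in> rank_le_tensors s1 s2 r"
        "z \<in> rank_le_tensors s1 s2 r" for x y z
      using that \<alpha>_triangle_diff[of x y z] by (simp add: dist rank_le_tensors_imp_tensor_space)
  qed
  have "M.mcomplete"
    unfolding M.mcomplete_def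
  proof (intro allI impI)
    fix Z assume Z: "M.MCauchy Z"
    then have Zr: "Z n \<in> rank_le_tensors s1 s2 r" for n by (auto simp: M.MCauchy_def)
    moreover have "\<alpha>_Cauchy Z"
      using Z by (simp add: M.MCauchy_def \<alpha>_Cauchy_def dist Zr)
    ultimately obtain z where z: "z \<in> rank_le_tensors s1 s2 r" "(\<lambda>n. \<alpha> (Z n - z)) \<longlonglongrightarrow> 0"
      using \<alpha>_Cauchy_convergent by blast
    have "limitin M.mtopology Z z sequentially"
      unfolding M.limit_metric_sequentially
    proof (intro conjI allI impI)
      fix e :: real assume "0 < e"
      then have "eventually (\<lambda>n. \<alpha> (Z n - z) < e) sequentially" using z(2) order_tendstoD(2) by blast
      then show "\<exists>N. \<forall>n\<ge>N. Z n \<in> rank_le_tensors s1 s2 r \<and> tensor_dist s1 s2 \<alpha> (Z n) z < e"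
        by (simp add: Zr z(1) dist eventually_sequentially)
    qed (rule z(1))
    then show "\<exists>z. limitin M.mtopology Z z sequentially" by blast
  qed
  with M.Metric_space_axioms show ?thesis by blast
qed

end
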